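(* Consider an action $a$ with arity $k\ge 2$ where each numeric constraint $c$ in the precondition $\mathit{pre}(a)$ has an arity of at most $2$, and a state $\mathcal{S}$. Let $\mathcal{G}_{a,\mathcal{S}}=\langle\mathcal{V},\mathcal{E}\rangle$ be the substitution consistency graph extended by numeric constraints, i.e. with $\mathcal{E}=\mathcal{V}^2\setminus(\mathcal{I}^{\neq}\cup\mathcal{I}^{+}\cup\mathcal{I}^{-}\cup\mathcal{I}^{\Delta})$. Then, there exists a $k$-clique $\mathcal{C}=\{v_1,\ldots,v_k\}$ in $\mathcal{G}_{a,\mathcal{S}}$ iff all ground numeric constraints $\overline{c}=c[v_1,\ldots,v_k]$ with $c$ in $\mathit{pre}(a)$ hold in $\mathcal{S}$.
   Context: **Syntax.** Fix sets of predicate symbols and function symbols, each symbol with an arity in $\mathbb{N}$, and a set $\mathcal{O}$ of objects (constants). An atom is $P(t_1,\ldots,t_m)$ with $P$ a predicate symbol of arity $m$ and each $t_i$ a variable or an object; a literal is an atom $p$ or its negation $\neg p$. A function term is $F(t_1,\ldots,t_m)$ with $F$ a function symbol of arity $m$ and each $t_i$ a variable or an object. A function expression is any expression built from function terms using the arithmetic operators $+,-,\times,\div$. A numeric constraint is $e\oplus e'$ with $e,e'$ function expressions and $\oplus\in\{=,<,>,\le,\ge\}$. For a syntactic element $y$ (atom, literal, constraint, action, ...), $\mathcal{X}(y)$ is its set of free variables and its arity is $|\mathcal{X}(y)|$; $y$ is ground iff $\mathcal{X}(y)=\emptyset$. **Substitutions.** A substitution function is a map $\rho$ from a set of variables to $\mathcal{O}$;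 $\mathcal{R}(\mathcal{X},\mathcal{O})$ is the set of those with domain $\mathcal{X}$. One writes $x_1/o_1,\ldots,x_n/o_n$ for the $\rho$ with $\rho(x_i)=o_i$. $y[\rho]$ denotes $y$ with every occurrence of each variable in the domain of $\rho$ replaced by its image. **States.** A state $\mathcal{S}$ consists of a set of ground atoms (those that hold in $\mathcal{S}$) and a set of ground function terms, each with an associated real value; ground function terms not in this set are undefined. The value of a ground function expression or ground numeric constraint in $\mathcal{S}$ is defined in the usual way from the values of its ground function terms. A ground numeric constraint holds in $\mathcal{S}$ iff it evaluates to true. **Actions.** An action $a$ has a precondition $\mathit{pre}(a)$, a set of literals and numeric constraints, and a set of effects. $\mathit{pre}^+(a)$ and $\mathit{pre}^-(a)$ are the sets of atoms of the positive and negative literals in $\mathit{pre}(a)$, and $\mathit{pre}^{\Delta}(a)$ is the set of numeric constraints in $\mathit{pre}(a)$. **Satisfiability.** A numeric constraint $c$ with nonempty set of free variables is satisfiable in $\mathcal{S}$, written $\mathcal{S}\vDash c$, iff there is $\rho\in\mathcal{R}(\mathcal{X}(c),\mathcal{O})$ such that the ground constraint $c[\rho]$ holds in $\mathcal{S}$; a ground constraint is satisfiable in $\mathcal{S}$ iff it holds in $\mathcal{S}$. Otherwise $c$ is unsatisfiable, written $\mathcal{S}\nvDash c$. **Graph.** $\mathcal{V}=\{x/o\mid x\in\mathcal{X}(a),\,o\in\mathcal{O}\}$; edges are unordered pairs $\{v,v'\}$, and $\mathcal{E}=\mathcal{V}^2\setminus(\mathcal{I}^{\neq}\cup\mathcal{I}^{+}\cup\mathcal{I}^{-}\cup\mathcal{I}^{\Delta})$,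 where - $\mathcal{I}^{\neq}=\{\{x/o_1,x/o_2\}\mid x\in\mathcal{X}(a),\,o_1,o_2\in\mathcal{O}\}$; - $\mathcal{I}^{+}$ is the set of $\{v,v'\}$ with $v,v'\in\mathcal{V}$ for which there is $p\in\mathit{pre}^+(a)$ such that $p[v,v']$ matches no ground atom of $\mathcal{S}$; here $P(t_1,\ldots,t_m)$ matches $P'(t_1',\ldots,t_m')$ iff $P=P'$ and for each $i$, $t_i$ or $t_i'$ is a variable, or else $t_i=t_i'$; - $\mathcal{I}^{-}$ is the set of $\{v,v'\}$ with $v,v'\in\mathcal{V}$ for which there is $p\in\mathit{pre}^-(a)$ such that $p[v,v']$ is ground and is an atom of $\mathcal{S}$; - $\mathcal{I}^{\Delta}$ is the set of $\{v,v'\}$ with $v,v'\in\mathcal{V}$ for which there is $c\in\mathit{pre}^{\Delta}(a)$ with $\mathcal{S}\nvDash c[v,v']$. A $k$-clique is a set of $k$ distinct, pairwise adjacent vertices.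
   Formalization: The right side of the "iff" additionally requires that v_1,…,v_k form a k-clique of the graph without I^Δ (only I^≠, I^+, I^- removed); otherwise "if" fails, e.g. pre(a)={P(x,y)} and a state with no atoms. *)

theory Defs
  imports Complex_Main
begin

section \<open>Syntax\<close>

text \<open>
  Variables are the elements of the type \<open>'x\<close>, and the set of objects is the whole type \<open>'o\<close>.
  Predicate and function symbols are the elements of \<open>'p\<close> and \<open>'f\<close>; their arities are imposed
  by the predicates \<open>wf_action\<close> and \<open>wf_state\<close> below.
\<close>

datatype ('x, 'o) trm = Var 'x | Obj 'o

datatype ('p, 'x, 'o) atm = Atom 'p "('x, 'o) trm list"

datatype ('p, 'x, 'o) literal = Pos "('p, 'x, 'o) atm" | Neg "('p, 'x, 'o) atm"

datatype ('f, 'x, 'o) fterm = FTerm 'f "('x, 'o) trm list"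

datatype arith_op = Plus | Minus | Times | Divide

datatype ('f, 'x, 'o) fexp =
    Fun "('f, 'x, 'o) fterm"
  | Arith arith_op "('f, 'x, 'o) fexp" "('f, 'x, 'o) fexp"

datatype cmp_op = Equal | Less | Greater | LessEq | GreaterEq

datatype ('f, 'x, 'o) ncon = NCon cmp_op "('f, 'x, 'o) fexp" "('f, 'x, 'o) fexp"

datatype ('p, 'f, 'x, 'o) cond = Lit "('p, 'x, 'o) literal" | Num "('f, 'x, 'o) ncon"

text \<open>
  Effects influence the substitution consistency graph only through their free variables,
  which count towards the arity of the action.  Their syntax is therefore left abstract:
  \<open>eff_vars\<close> yields the free variables of a single effect.
\<close>

record ('p, 'f, 'x, 'o, 'e) action =
  pre :: "('p, 'f, 'x, 'o) cond set"
  eff :: "'e set"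
  eff_vars :: "'e \<Rightarrow> 'x set"

definition pre_pos :: "('p, 'f, 'x, 'o, 'e) action \<Rightarrow> ('p, 'x, 'o) atm set" where
  "pre_pos a = {p. Lit (Pos p) \<in> pre a}"

definition pre_neg :: "('p, 'f, 'x, 'o, 'e) action \<Rightarrow> ('p, 'x, 'o) atm set" where
  "pre_neg a = {p. Lit (Neg p) \<in> pre a}"

definition pre_num :: "('p, 'f, 'x, 'o, 'e) action \<Rightarrow> ('f, 'x, 'o) ncon set" where
  "pre_num a = {c. Num c \<in> pre a}"


section \<open>Free variables\<close>

primrec vars_trm :: "('x, 'o) trm \<Rightarrow> 'x set" where
  "vars_trm (Var x) = {x}"
| "vars_trm (Obj b) = {}"

primrec vars_atm :: "('p, 'x, 'o) atm \<Rightarrow> 'x set" where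
  "vars_atm (Atom P ts) = (\<Union>t\<in>set ts. vars_trm t)"

primrec vars_literal :: "('p, 'x, 'o) literal \<Rightarrow> 'x set" where
  "vars_literal (Pos p) = vars_atm p"
| "vars_literal (Neg p) = vars_atm p"

primrec vars_fterm :: "('f, 'x, 'o) fterm \<Rightarrow> 'x set" where
  "vars_fterm (FTerm F ts) = (\<Union>t\<in>set ts. vars_trm t)"

primrec vars_fexp :: "('f, 'x, 'o) fexp \<Rightarrow> 'x set" where
  "vars_fexp (Fun t) = vars_fterm t"
| "vars_fexp (Arith b e1 e2) = vars_fexp e1 \<union> vars_fexp e2"

primrec vars_ncon :: "('f, 'x, 'o) ncon \<Rightarrow> 'x set" where
  "vars_ncon (NCon r e1 e2) = vars_fexp e1 \<union> vars_fexp e2"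

primrec vars_cond :: "('p, 'f, 'x, 'o) cond \<Rightarrow> 'x set" where
  "vars_cond (Lit l) = vars_literal l"
| "vars_cond (Num c) = vars_ncon c"

definition vars_action :: "('p, 'f, 'x, 'o, 'e) action \<Rightarrow> 'x set" where
  "vars_action a = (\<Union>q\<in>pre a. vars_cond q) \<union> (\<Union>e\<in>eff a. eff_vars a e)"


section \<open>Substitutions\<close>

type_synonym ('x, 'o) subst = "'x \<rightharpoonup> 'o"

definition substs :: "'x set \<Rightarrow> ('x, 'o) subst set" where
  "substs X = {\<rho>. dom \<rho> = X}"

primrec subst_trm :: "('x, 'o) trm \<Rightarrow> ('x, 'o) subst \<Rightarrow> ('x, 'o) trm" where
  "subst_trm (Var x) \<rho> = (case \<rho> x of None \<Rightarrow> Var x | Some b \<Rightarrow> Obj b)"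
| "subst_trm (Obj b) \<rho> = Obj b"

primrec subst_atm :: "('p, 'x, 'o) atm \<Rightarrow> ('x, 'o) subst \<Rightarrow> ('p, 'x, 'o) atm" where
  "subst_atm (Atom P ts) \<rho> = Atom P (map (\<lambda>t. subst_trm t \<rho>) ts)"

primrec subst_fterm :: "('f, 'x, 'o) fterm \<Rightarrow> ('x, 'o) subst \<Rightarrow> ('f, 'x, 'o) fterm" where
  "subst_fterm (FTerm F ts) \<rho> = FTerm F (map (\<lambda>t. subst_trm t \<rho>) ts)"

primrec subst_fexp :: "('f, 'x, 'o) fexp \<Rightarrow> ('x, 'o) subst \<Rightarrow> ('f, 'x, 'o) fexp" where
  "subst_fexp (Fun t) \<rho> = Fun (subst_fterm t \<rho>)"
| "subst_fexp (Arith b e1 e2) \<rho> = Arith b (subst_fexp e1 \<rho>) (subst_fexp e2 \<rho>)"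

primrec subst_ncon :: "('f, 'x, 'o) ncon \<Rightarrow> ('x, 'o) subst \<Rightarrow> ('f, 'x, 'o) ncon" where
  "subst_ncon (NCon r e1 e2) \<rho> = NCon r (subst_fexp e1 \<rho>) (subst_fexp e2 \<rho>)"


section \<open>States\<close>

record ('p, 'f, 'x, 'o) state =
  atoms :: "('p, 'x, 'o) atm set"
  fval :: "('f, 'x, 'o) fterm \<rightharpoonup> real"

text \<open>
  The value \<open>None\<close> means undefined.  Undefinedness propagates through all operators, and division
  by zero is undefined (whereas \<open>x / 0 = 0\<close> in HOL).
\<close>

primrec arith :: "arith_op \<Rightarrow> real \<Rightarrow> real \<Rightarrow> real option" where
  "arith Plus u v = Some (u + v)"
| "arith Minus u v = Some (u - v)"
| "arith Times u v = Some (u * v)"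
| "arith Divide u v = (if v = 0 then None else Some (u / v))"

primrec fexp_value :: "('p, 'f, 'x, 'o) state \<Rightarrow> ('f, 'x, 'o) fexp \<Rightarrow> real option" where
  "fexp_value S (Fun t) = fval S t"
| "fexp_value S (Arith b e1 e2) =
    (case (fexp_value S e1, fexp_value S e2) of
       (Some u, Some v) \<Rightarrow> arith b u v
     | _ \<Rightarrow> None)"

primrec compare :: "cmp_op \<Rightarrow> real \<Rightarrow> real \<Rightarrow> bool" where
  "compare Equal u v \<longleftrightarrow> u = v"
| "compare Less u v \<longleftrightarrow> u < v"
| "compare Greater u v \<longleftrightarrow> u > v"
| "compare LessEq u v \<longleftrightarrow> u \<le> v"
| "compare GreaterEq u v \<longleftrightarrow> u \<ge> v"

text \<open>A constraint with an undefined side does not hold.\<close>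

primrec holds :: "('p, 'f, 'x, 'o) state \<Rightarrow> ('f, 'x, 'o) ncon \<Rightarrow> bool" where
  "holds S (NCon r e1 e2) \<longleftrightarrow>
    (\<exists>u v. fexp_value S e1 = Some u \<and> fexp_value S e2 = Some v \<and> compare r u v)"

definition satisfiable :: "('p, 'f, 'x, 'o) state \<Rightarrow> ('f, 'x, 'o) ncon \<Rightarrow> bool" where
  "satisfiable S c \<longleftrightarrow>
    (if vars_ncon c = {} then holds S c
     else \<exists>\<rho>\<in>substs (vars_ncon c). holds S (subst_ncon c \<rho>))"


section \<open>Well-formedness\<close>

primrec wf_atm :: "('p \<Rightarrow> nat) \<Rightarrow> ('p, 'x, 'o) atm \<Rightarrow> bool" where
  "wf_atm par (Atom P ts) \<longleftrightarrow> length ts = par P"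

primrec wf_literal :: "('p \<Rightarrow> nat) \<Rightarrow> ('p, 'x, 'o) literal \<Rightarrow> bool" where
  "wf_literal par (Pos p) \<longleftrightarrow> wf_atm par p"
| "wf_literal par (Neg p) \<longleftrightarrow> wf_atm par p"

primrec wf_fterm :: "('f \<Rightarrow> nat) \<Rightarrow> ('f, 'x, 'o) fterm \<Rightarrow> bool" where
  "wf_fterm far (FTerm F ts) \<longleftrightarrow> length ts = far F"

primrec wf_fexp :: "('f \<Rightarrow> nat) \<Rightarrow> ('f, 'x, 'o) fexp \<Rightarrow> bool" where
  "wf_fexp far (Fun t) \<longleftrightarrow> wf_fterm far t"
| "wf_fexp far (Arith b e1 e2) \<longleftrightarrow> wf_fexp far e1 \<and> wf_fexp far e2"

primrec wf_ncon :: "('f \<Rightarrow> nat) \<Rightarrow> ('f, 'x, 'o) ncon \<Rightarrow> bool" where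
  "wf_ncon far (NCon r e1 e2) \<longleftrightarrow> wf_fexp far e1 \<and> wf_fexp far e2"

primrec wf_cond :: "('p \<Rightarrow> nat) \<Rightarrow> ('f \<Rightarrow> nat) \<Rightarrow> ('p, 'f, 'x, 'o) cond \<Rightarrow> bool" where
  "wf_cond par far (Lit l) \<longleftrightarrow> wf_literal par l"
| "wf_cond par far (Num c) \<longleftrightarrow> wf_ncon far c"

definition wf_action ::
  "('p \<Rightarrow> nat) \<Rightarrow> ('f \<Rightarrow> nat) \<Rightarrow> ('p, 'f, 'x, 'o, 'e) action \<Rightarrow> bool" where
  "wf_action par far a \<longleftrightarrow> (\<forall>q\<in>pre a. wf_cond par far q)"

definition wf_state ::
  "('p \<Rightarrow> nat) \<Rightarrow> ('f \<Rightarrow> nat) \<Rightarrow> ('p, 'f, 'x, 'o) state \<Rightarrow> bool" where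
  "wf_state par far S \<longleftrightarrow>
    (\<forall>p\<in>atoms S. wf_atm par p \<and> vars_atm p = {}) \<and>
    (\<forall>t\<in>dom (fval S). wf_fterm far t \<and> vars_fterm t = {})"


section \<open>The substitution consistency graph\<close>

text \<open>
  A vertex \<open>x/o\<close> is the pair \<open>(x, o)\<close>, and \<open>y[v\<^sub>1, \<dots>, v\<^sub>n]\<close> is the application of the
  substitution \<open>map_of [v\<^sub>1, \<dots>, v\<^sub>n]\<close> to \<open>y\<close>.  If two of the vertices assign different objects to
  the same variable, this notation has no meaning of its own, and \<open>map_of\<close> takes the first one;
  such pairs are never edges, because they belong to \<open>I_neq\<close>.
\<close>

type_synonym ('x, 'o) vertex = "'x \<times> 'o"

fun term_matches :: "('x, 'o) trm \<Rightarrow> ('x, 'o) trm \<Rightarrow> bool" where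
  "term_matches (Obj b) (Obj b') \<longleftrightarrow> b = b'"
| "term_matches _ _ \<longleftrightarrow> True"

fun matches :: "('p, 'x, 'o) atm \<Rightarrow> ('p, 'x, 'o) atm \<Rightarrow> bool" where
  "matches (Atom P ts) (Atom P' ts') \<longleftrightarrow> P = P' \<and> list_all2 term_matches ts ts'"

definition vertices :: "('p, 'f, 'x, 'o, 'e) action \<Rightarrow> ('x, 'o) vertex set" where
  "vertices a = vars_action a \<times> UNIV"

definition vertex_pairs ::
  "('p, 'f, 'x, 'o, 'e) action \<Rightarrow> ('x, 'o) vertex set set" where
  "vertex_pairs a = {{v, v'} | v v'. v \<in> vertices a \<and> v' \<in> vertices a}"

definition I_neq :: "('p, 'f, 'x, 'o, 'e) action \<Rightarrow> ('x, 'o) vertex set set" where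
  "I_neq a = {{(x, b1), (x, b2)} | x b1 b2. x \<in> vars_action a}"

definition I_pos ::
  "('p, 'f, 'x, 'o, 'e) action \<Rightarrow> ('p, 'f, 'x, 'o) state \<Rightarrow> ('x, 'o) vertex set set" where
  "I_pos a S = {{v, v'} | v v'. v \<in> vertices a \<and> v' \<in> vertices a \<and>
     (\<exists>p\<in>pre_pos a. \<not> (\<exists>q\<in>atoms S. matches (subst_atm p (map_of [v, v'])) q))}"

definition I_neg ::
  "('p, 'f, 'x, 'o, 'e) action \<Rightarrow> ('p, 'f, 'x, 'o) state \<Rightarrow> ('x, 'o) vertex set set" where
  "I_neg a S = {{v, v'} | v v'. v \<in> vertices a \<and> v' \<in> vertices a \<and>
     (\<exists>p\<in>pre_neg a. vars_atm (subst_atm p (map_of [v, v'])) = {} \<and>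
        subst_atm p (map_of [v, v']) \<in> atoms S)}"

definition I_num ::
  "('p, 'f, 'x, 'o, 'e) action \<Rightarrow> ('p, 'f, 'x, 'o) state \<Rightarrow> ('x, 'o) vertex set set" where
  "I_num a S = {{v, v'} | v v'. v \<in> vertices a \<and> v' \<in> vertices a \<and>
     (\<exists>c\<in>pre_num a. \<not> satisfiable S (subst_ncon c (map_of [v, v'])))}"

text \<open>
  The edges of the substitution consistency graph: \<open>lit_edges\<close> takes only the literals of the
  precondition into account, \<open>edges\<close> is its extension by numeric constraints.
\<close>

definition lit_edges ::
  "('p, 'f, 'x, 'o, 'e) action \<Rightarrow> ('p, 'f, 'x, 'o) state \<Rightarrow> ('x, 'o) vertex set set" where
  "lit_edges a S = vertex_pairs a - (I_neq a \<union> I_pos a S \<union> I_neg a S)"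

definition edges ::
  "('p, 'f, 'x, 'o, 'e) action \<Rightarrow> ('p, 'f, 'x, 'o) state \<Rightarrow> ('x, 'o) vertex set set" where
  "edges a S = vertex_pairs a - (I_neq a \<union> I_pos a S \<union> I_neg a S \<union> I_num a S)"

definition k_clique :: "nat \<Rightarrow> 'v set \<Rightarrow> 'v set set \<Rightarrow> 'v set \<Rightarrow> bool" where
  "k_clique k V E C \<longleftrightarrow>
    C \<subseteq> V \<and> finite C \<and> card C = k \<and> (\<forall>v\<in>C. \<forall>v'\<in>C. v \<noteq> v' \<longrightarrow> {v, v'} \<in> E)"

end

theory Submission
  imports Defs
begin

text \<open>
  A \<open>k\<close>-clique avoids \<open>I_neq\<close>, hence by counting it assigns exactly one object to each of the
  \<open>k\<close> variables of the action and grounds every precondition.  Since \<open>k \<ge> 2\<close>, the at most two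
  variables of a numeric constraint are covered by a single pair of distinct clique vertices, so
  that constraint is decided on an edge.  Conversely, a constraint that holds under the full
  assignment is satisfiable after any partial one: the full assignment completes it.
\<close>

lemma finite_vars_trm: "finite (vars_trm t)"
  by (cases t) auto

lemma finite_vars_fexp: "finite (vars_fexp e)"
proof (induction e)
  case (Fun t)
  then show ?case by (cases t) (auto simp: finite_vars_trm)
qed auto

text \<open>Since \<open>card\<close> is 0 on infinite sets, an arity bound stated by
  \<open>card\<close> limits the number of variables only together with finiteness.\<close>

lemma finite_vars_ncon: "finite (vars_ncon c)"
  by (cases c) (auto simp: finite_vars_fexp)

lemma subst_trm_cong:
  "(\<And>x. x \<in> vars_trm t \<Longrightarrow> \<sigma> x = \<tau> x) \<Longrightarrow> subst_trm t \<sigma> = subst_trm t \<tau>"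
  by (cases t) auto

lemma subst_fterm_cong:
  "(\<And>x. x \<in> vars_fterm t \<Longrightarrow> \<sigma> x = \<tau> x) \<Longrightarrow> subst_fterm t \<sigma> = subst_fterm t \<tau>"
  by (cases t) (auto intro!: subst_trm_cong)

lemma subst_fexp_cong:
  "(\<And>x. x \<in> vars_fexp e \<Longrightarrow> \<sigma> x = \<tau> x) \<Longrightarrow> subst_fexp e \<sigma> = subst_fexp e \<tau>"
  by (induction e) (auto intro!: subst_fterm_cong)

lemma subst_ncon_cong:
  "(\<And>x. x \<in> vars_ncon c \<Longrightarrow> \<sigma> x = \<tau> x) \<Longrightarrow> subst_ncon c \<sigma> = subst_ncon c \<tau>"
  by (cases c) (auto intro!: subst_fexp_cong)

lemma vars_subst_trm: "vars_trm (subst_trm t \<sigma>) = vars_trm t - dom \<sigma>"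
  by (cases t) (auto split: option.split)

lemma vars_subst_fexp: "vars_fexp (subst_fexp e \<sigma>) = vars_fexp e - dom \<sigma>"
proof (induction e)
  case (Fun t)
  then show ?case by (cases t) (auto simp: vars_subst_trm)
qed auto

lemma vars_subst_ncon: "vars_ncon (subst_ncon c \<sigma>) = vars_ncon c - dom \<sigma>"
  by (cases c) (auto simp: vars_subst_fexp)

text \<open>What \<sigma> replaces becomes the very object that \<tau> would insert, and objects are
  left alone; the remaining variables still await \<tau>.\<close>

lemma subst_trm_absorb: "\<sigma> \<subseteq>\<^sub>m \<tau> \<Longrightarrow> subst_trm (subst_trm t \<sigma>) \<tau> = subst_trm t \<tau>"
  by (cases t) (auto simp: map_le_def dom_def split: option.split)

lemma subst_fexp_absorb: "\<sigma> \<subseteq>\<^sub>m \<tau> \<Longrightarrow> subst_fexp (subst_fexp e \<sigma>) \<tau> = subst_fexp e \<tau>"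
proof (induction e)
  case (Fun t)
  then show ?case by (cases t) (auto simp: subst_trm_absorb)
qed auto

lemma subst_ncon_absorb: "\<sigma> \<subseteq>\<^sub>m \<tau> \<Longrightarrow> subst_ncon (subst_ncon c \<sigma>) \<tau> = subst_ncon c \<tau>"
  by (cases c) (auto simp: subst_fexp_absorb)

lemma satisfiable_partial_subst:
  assumes "\<sigma> \<subseteq>\<^sub>m \<tau>" "vars_ncon c \<subseteq> dom \<tau>" "holds S (subst_ncon c \<tau>)"
  shows "satisfiable S (subst_ncon c \<sigma>)"
proof (cases "vars_ncon (subst_ncon c \<sigma>) = {}")
  case True
  then have "vars_ncon c \<subseteq> dom \<sigma>"
    by (auto simp: vars_subst_ncon)
  then have "subst_ncon c \<sigma> = subst_ncon c \<tau>"
    using assms(1) by (intro subst_ncon_cong) (auto simp: map_le_def)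
  with True assms(3) show ?thesis
    by (simp add: satisfiable_def)
next
  case False
  let ?d = "subst_ncon c \<sigma>"
  \<comment> \<open>\<open>satisfiable\<close> asks for a substitution whose domain is exactly the
    set of remaining variables, so \<tau> is cut down to them.\<close>
  let ?\<rho> = "\<tau> |` vars_ncon ?d"
  have "subst_ncon ?d ?\<rho> = subst_ncon ?d \<tau>"
    by (intro subst_ncon_cong) auto
  then have "holds S (subst_ncon ?d ?\<rho>)"
    using assms by (simp add: subst_ncon_absorb)
  moreover have "?\<rho> \<in> substs (vars_ncon ?d)"
    using assms(2) by (auto simp: substs_def vars_subst_ncon)
  ultimately show ?thesis
    using False by (auto simp: satisfiable_def)
qed

text \<open>Constraints with no variable or only one must also be decided on an edge, whose
  endpoints carry distinct variables; hence the padding to exactly two elements.\<close>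

lemma pair_superset:
  assumes "finite B" "card B \<le> 2" "B \<subseteq> A" "card A \<ge> 2"
  obtains x y where "x \<in> A" "y \<in> A" "x \<noteq> y" "B \<subseteq> {x, y}"
proof -
  have "\<exists>D. B \<subseteq> D \<and> D \<subseteq> A \<and> card D = 2"
    using assms by (intro exists_subset_between) (auto intro: card_ge_0_finite)
  then show thesis
    using that by (auto simp: card_2_iff)
qed

lemma k_clique_mono: "k_clique k V E C \<Longrightarrow> E \<subseteq> F \<Longrightarrow> k_clique k V F C"
  unfolding k_clique_def by blast

lemma edges_eq: "edges a S = lit_edges a S - I_num a S"
  by (auto simp: edges_def lit_edges_def)

lemma vars_pre_num: "c \<in> pre_num a \<Longrightarrow> vars_ncon c \<subseteq> vars_action a"
  unfolding pre_num_def vars_action_def by fastforce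

lemma lit_clique_fst:
  assumes "k_clique k (vertices a) (lit_edges a S) C"
    and "card (vars_action a) = k" "k > 0"
  shows "inj_on fst C" "fst ` C = vars_action a"
proof -
  have C: "C \<subseteq> vertices a" "card C = k"
    and e: "\<And>v v'. v \<in> C \<Longrightarrow> v' \<in> C \<Longrightarrow> v \<noteq> v' \<Longrightarrow> {v, v'} \<in> lit_edges a S"
    using assms(1) by (auto simp: k_clique_def)
  show inj: "inj_on fst C"
  proof (rule inj_onI, rule ccontr)
    fix v v' assume v: "v \<in> C" "v' \<in> C" "fst v = fst v'" "v \<noteq> v'"
    then have "{v, v'} = {(fst v, snd v), (fst v, snd v')}" "fst v \<in> vars_action a"
      using C(1) by (auto simp: vertices_def prod_eq_iff)
    then have "{v, v'} \<in> I_neq a"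
      unfolding I_neq_def by blast
    with e[OF v(1,2,4)] show False
      by (simp add: lit_edges_def)
  qed
  \<comment> \<open>An infinite set would have \<open>card\<close> 0, contrary to
    \<open>k > 0\<close>.\<close>
  have "finite (vars_action a)"
    using assms(2,3) by (auto intro: card_ge_0_finite)
  moreover have "fst ` C \<subseteq> vars_action a"
    using C(1) by (auto simp: vertices_def)
  ultimately show "fst ` C = vars_action a"
    using card_image[OF inj] C(2) assms(2) by (simp add: card_subset_eq)
qed

text \<open>Numeric constraints only remove edges, so both sides fail unless \<open>set vs\<close>
  is a clique for the literals. If it is one, \<open>map_of vs\<close> is a total assignment, and
  only avoidance of \<open>I_num\<close> remains to be compared with truth of the
  constraints.\<close>

lemma edge_clique_iff_holds:
  assumes k: "card (vars_action a) = k" "k \<ge> 2"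
    and ar: "\<forall>c\<in>pre_num a. card (vars_ncon c) \<le> 2"
    and len: "length vs = k"
  shows "k_clique k (vertices a) (edges a S) (set vs) \<longleftrightarrow>
    k_clique k (vertices a) (lit_edges a S) (set vs) \<and>
    (\<forall>c\<in>pre_num a. vars_ncon (subst_ncon c (map_of vs)) = {} \<and>
       holds S (subst_ncon c (map_of vs)))"
    (is "?L \<longleftrightarrow> ?K \<and> ?H")
proof (cases ?K)
  case False
  then show ?thesis
    using k_clique_mono edges_eq by blast
next
  case True
  have inj: "inj_on fst (set vs)" and img: "fst ` set vs = vars_action a"
    using lit_clique_fst[OF True k(1)] k(2) by auto
  have "distinct vs"
    using True len by (simp add: k_clique_def card_distinct)
  \<comment> \<open>Distinct vertices and injective \<open>fst\<close> give distinct keys, so no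
    entry of \<open>vs\<close> shadows another in \<open>map_of\<close>.\<close>
  then have mo: "map_of vs x = Some b \<longleftrightarrow> (x, b) \<in> set vs" for x b
    using inj by (simp add: distinct_map)
  have dom: "dom (map_of vs) = vars_action a"
    using img by (simp add: dom_map_of_conv_image_fst)
  have pair: "map_of [v, v'] \<subseteq>\<^sub>m map_of vs"
    if "v \<in> set vs" "v' \<in> set vs" for v v'
  proof -
    have "map_of vs (fst v) = Some (snd v)" "map_of vs (fst v') = Some (snd v')"
      using that mo by auto
    then show ?thesis
      by (auto simp: map_le_def split: if_splits)
  qed
  have L: "?L \<longleftrightarrow> (\<forall>v\<in>set vs. \<forall>v'\<in>set vs. v \<noteq> v' \<longrightarrow> {v, v'} \<notin> I_num a S)"
    using True by (auto simp: k_clique_def edges_eq)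
  have "?L \<longleftrightarrow> ?H"
  proof
    assume ?L
    show ?H
    proof (intro ballI conjI)
      fix c assume c: "c \<in> pre_num a"
      show "vars_ncon (subst_ncon c (map_of vs)) = {}"
        using vars_pre_num[OF c] dom by (simp add: vars_subst_ncon)
      obtain x y where xy: "x \<in> vars_action a" "y \<in> vars_action a" "x \<noteq> y"
          "vars_ncon c \<subseteq> {x, y}"
        using pair_superset[OF finite_vars_ncon _ vars_pre_num[OF c]] ar c k by metis
      obtain b d where vs: "(x, b) \<in> set vs" "(y, d) \<in> set vs"
        using xy(1,2) img by force
      let ?\<sigma> = "map_of [(x, b), (y, d)]"
      have "(x, b) \<in> vertices a" "(y, d) \<in> vertices a"
        using xy by (auto simp: vertices_def)
      moreover have "{(x, b), (y, d)} \<notin> I_num a S"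
        using \<open>?L\<close> vs xy(3) L by blast
      ultimately have "satisfiable S (subst_ncon c ?\<sigma>)"
        using c unfolding I_num_def by blast
      \<comment> \<open>On a ground constraint satisfiability is truth, and ?\<sigma> agrees with
        the full assignment on the variables of \<open>c\<close>.\<close>
      moreover have "vars_ncon (subst_ncon c ?\<sigma>) = {}"
        using xy(4) by (auto simp: vars_subst_ncon)
      moreover have "subst_ncon c ?\<sigma> = subst_ncon c (map_of vs)"
        using xy(4) pair[OF vs] by (intro subst_ncon_cong) (auto simp: map_le_def)
      ultimately show "holds S (subst_ncon c (map_of vs))"
        by (simp add: satisfiable_def)
    qed
  next
    assume H: ?H
    have "{v, v'} \<notin> I_num a S" if v: "v \<in> set vs" "v' \<in> set vs" for v v'
    proof
      assume "{v, v'} \<in> I_num a S"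
      \<comment> \<open>Pairs are unordered, so the failing substitution may list the two vertices
        in either order; both orders are restrictions of \<open>map_of vs\<close>.\<close>
      then obtain w w' c where w: "{v, v'} = {w, w'}" and c: "c \<in> pre_num a"
        and unsat: "\<not> satisfiable S (subst_ncon c (map_of [w, w']))"
        unfolding I_num_def by blast
      have "w \<in> set vs" "w' \<in> set vs"
        using v w by (auto simp: doubleton_eq_iff)
      then have "satisfiable S (subst_ncon c (map_of [w, w']))"
        using satisfiable_partial_subst[OF pair] vars_pre_num[OF c] dom H c by blast
      with unsat show False ..
    qed
    then show ?L
      using L by blast
  qed
  with True show ?thesis by blast
qed

text \<open>Truth of the numeric constraints says nothing about the literals, so the right-hand
  sides also require a clique for \<open>lit_edges\<close>. Lists enumerate the vertices because
  \<open>map_of\<close> turns them into the substitution.\<close>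

theorem theorem2:
  fixes par :: "'p \<Rightarrow> nat" and far :: "'f \<Rightarrow> nat"
    and a :: "('p, 'f, 'x, 'o, 'e) action"
    and S :: "('p, 'f, 'x, 'o) state"
    and k :: nat
  assumes "wf_action par far a"
    and "wf_state par far S"
    and "card (vars_action a) = k"
    and "k \<ge> 2"
    and "\<forall>c\<in>pre_num a. card (vars_ncon c) \<le> 2"
  shows "(\<forall>vs. length vs = k \<longrightarrow>
            (k_clique k (vertices a) (edges a S) (set vs) \<longleftrightarrow>
             k_clique k (vertices a) (lit_edges a S) (set vs) \<and>
             (\<forall>c\<in>pre_num a. vars_ncon (subst_ncon c (map_of vs)) = {} \<and>
                holds S (subst_ncon c (map_of vs))))) \<and>
         ((\<exists>C. k_clique k (vertices a) (edges a S) C) \<longleftrightarrow>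
          (\<exists>vs. length vs = k \<and>
             k_clique k (vertices a) (lit_edges a S) (set vs) \<and>
             (\<forall>c\<in>pre_num a. vars_ncon (subst_ncon c (map_of vs)) = {} \<and>
                holds S (subst_ncon c (map_of vs)))))"
proof (intro conjI allI impI)
  show char: "k_clique k (vertices a) (edges a S) (set vs) \<longleftrightarrow>
      k_clique k (vertices a) (lit_edges a S) (set vs) \<and>
      (\<forall>c\<in>pre_num a. vars_ncon (subst_ncon c (map_of vs)) = {} \<and>
         holds S (subst_ncon c (map_of vs)))" if "length vs = k" for vs
    using edge_clique_iff_holds[OF assms(3-5) that] .
  \<comment> \<open>A finite clique listed without repetition has length \<open>k\<close>, which
    carries the equivalence from lists over to sets.\<close>
  have "\<exists>vs. set vs = C \<and> length vs = k" if "k_clique k (vertices a) (edges a S) C" for C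
    using that finite_distinct_list[of C] by (auto simp: k_clique_def distinct_card)
  then show "(\<exists>C. k_clique k (vertices a) (edges a S) C) \<longleftrightarrow>
      (\<exists>vs. length vs = k \<and>
         k_clique k (vertices a) (lit_edges a S) (set vs) \<and>
         (\<forall>c\<in>pre_num a. vars_ncon (subst_ncon c (map_of vs)) = {} \<and>
            holds S (subst_ncon c (map_of vs))))"
    using char by metis
qed

end
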